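(* Let $u_0\in\mathcal M$, $\theta\ge0$ and $\tau>0$, let $u$ be the solution of $\partial_tu=-\Pi_uP(\mathcal B)u$, $u(0)=u_0$, and let $u_\infty=\mathsf E_*u_0/\|\mathsf E_*u_0\|_H$. Then $u(t)\in\mathcal D(\mathcal A^\theta)$ for all $t>0$, and $$u(t)\longrightarrow u_\infty\quad\text{in }\mathcal D(\mathcal A^\theta)\quad\text{as }t\to\infty .$$ If $\Sigma_P(u_0)\setminus\{\mu_*(u_0)\}\ne\varnothing$, so that the active spectral gap $\delta_*(u_0)$ is defined, then there exists a (finite) constant $C_{\theta,\tau}(u_0)>0$ such that $$\|\mathcal A^\theta(u(t)-u_\infty)\|_H\le C_{\theta,\tau}(u_0)e^{-\delta_*(u_0)t},\qquad t\ge\tau .$$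
   Context: Let $d\ge1$, let $\Omega\subset\mathbb R^d$ be a bounded connected domain with $C^\infty$ boundary, and let $H=L^2(\Omega)$ (real) with its usual inner product $\langle\cdot,\cdot\rangle_H$ and norm $\|\cdot\|_H$. Let $\mathcal B=-\Delta_D$ be the positive Dirichlet Laplacian, $\mathcal D(\mathcal B)=H^2(\Omega)\cap H^1_0(\Omega)$, with eigenvalues $0<\lambda_1\le\lambda_2\le\cdots$, $\lambda_j\to\infty$ (repeated according to multiplicity) and orthonormal basis $\{e_j\}_{j\ge1}$ of $H$ with $\mathcal Be_j=\lambda_je_j$. Let $P(s)=a_ms^m+\cdots+a_0$ be a real polynomial of degree $m\ge1$ with $a_m>0$. For $u=\sum_ju_je_j$, $u_j=\langle u,e_j\rangle_H$, set $P(\mathcal B)u=\sum_jP(\lambda_j)u_je_j$ on $\mathcal D(P(\mathcal B))=\{u\in H:\sum_j|P(\lambda_j)|^2|u_j|^2<\infty\}$ (graph norm), and $S_P(t)u=e^{-tP(\mathcal B)}u=\sum_je^{-tP(\lambda_j)}u_je_j$. Put $\mu_P=\min_{s\ge\lambda_1}P(s)$, fix $\kappa>\max\{0,1-\mu_P\}$, set $\mathcal A=P(\mathcal B)+\kappa I$, $q_j=P(\lambda_j)+\kappa\ge1$, and for $\theta\ge0$ set $\mathcal A^\theta u=\sum_jq_j^\theta u_je_j$ on $\mathcal D(\mathcal A^\theta)=\{u\in H:\sum_jq_j^{2\theta}|u_j|^2<\infty\}$ with norm $\|\mathcal A^\theta u\|_H$. Let $\mathcal M=\{u\in H:\|u\|_H=1\}$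 and $\Pi_uv=v-\langle v,u\rangle_Hu$ for $u\in\mathcal M$, $v\in H$. The solution of $\partial_tu=-\Pi_uP(\mathcal B)u$ ($t>0$), $u(0)=u_0\in\mathcal M$, is the unique $\mathcal M$-valued solution in $C([0,\infty);H)\cap C((0,\infty);\mathcal D(P(\mathcal B)))\cap C^1((0,\infty);H)$, namely $u(t)=S_P(t)u_0/\|S_P(t)u_0\|_H$. The active polynomial spectral set of $u_0$ is $\Sigma_P(u_0)=\{P(\lambda_j):\langle u_0,e_j\rangle_H\ne0\}$, $\mu_*(u_0)=\min\Sigma_P(u_0)$ (the minimum exists since $P(\lambda_j)\to+\infty$), and $\mathsf E_*$ is the orthogonal projection of $H$ onto $\ker(P(\mathcal B)-\mu_*(u_0)I)$ (so $\mathsf E_*u_0\neq0$). When $\Sigma_P(u_0)\setminus\{\mu_*(u_0)\}\ne\varnothing$, the active spectral gap is $\delta_*(u_0)=\min\{\mu-\mu_*(u_0):\mu\in\Sigma_P(u_0),\ \mu>\mu_*(u_0)\}$. *)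

theory Defs
  imports "HOL-Analysis.Analysis" "HOL-Computational_Algebra.Polynomial"
begin

definition square_integrable :: "('a::euclidean_space \<Rightarrow> real) \<Rightarrow> bool" where
  "square_integrable f \<longleftrightarrow>
     f \<in> borel_measurable lebesgue \<and> integrable lebesgue (\<lambda>x. (f x)\<^sup>2)"

lemma square_integrable_mult:
  assumes "square_integrable f" "square_integrable g"
  shows "integrable lebesgue (\<lambda>x. f x * g x)"
proof (rule Bochner_Integration.integrable_bound)
  show "integrable lebesgue (\<lambda>x. (f x)\<^sup>2 + (g x)\<^sup>2)"
    using assms by (simp add: square_integrable_def)
  show "(\<lambda>x. f x * g x) \<in> borel_measurable lebesgue"
    using assms unfolding square_integrable_def by (intro borel_measurable_times) auto
  have "\<bar>a * b\<bar> \<le> a\<^sup>2 + b\<^sup>2" for a b :: real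
  proof -
    have "2 * (\<bar>a\<bar> * \<bar>b\<bar>) \<le> a\<^sup>2 + b\<^sup>2"
      using sum_squares_bound[of "\<bar>a\<bar>" "\<bar>b\<bar>"] by simp
    moreover have "0 \<le> \<bar>a\<bar> * \<bar>b\<bar>"
      by simp
    ultimately show ?thesis
      unfolding abs_mult by linarith
  qed
  then show "AE x in lebesgue. norm (f x * g x) \<le> norm ((f x)\<^sup>2 + (g x)\<^sup>2)"
    by (intro AE_I2) (simp add: abs_mult)
qed

lemma square_integrable_add:
  assumes "square_integrable f" "square_integrable g"
  shows "square_integrable (\<lambda>x. f x + g x)"
  using assms square_integrable_mult[OF assms]
  by (auto simp: square_integrable_def power2_sum mult.assoc)

lemma square_integrable_scale:
  "square_integrable f \<Longrightarrow> square_integrable (\<lambda>x. c * f x)"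
  by (auto simp: square_integrable_def power_mult_distrib)

lemma square_integrable_diff:
  assumes "square_integrable f" "square_integrable g"
  shows "square_integrable (\<lambda>x. f x - g x)"
  using square_integrable_add[OF assms(1) square_integrable_scale[OF assms(2), of "-1"]] by simp

lemma square_integrable_zero: "square_integrable (\<lambda>x. 0)"
  by (simp add: square_integrable_def)

definition l2_rel :: "('a::euclidean_space \<Rightarrow> real) \<Rightarrow> ('a \<Rightarrow> real) \<Rightarrow> bool" where
  "l2_rel f g \<longleftrightarrow>
     square_integrable f \<and> square_integrable g \<and> (AE x in lebesgue. f x = g x)"

quotient_type (overloaded) 'a l2 = "'a::euclidean_space \<Rightarrow> real" / partial: l2_rel
proof (rule part_equivpI)
  show "\<exists>f::'a \<Rightarrow> real. l2_rel f f"
    using square_integrable_zero by (auto simp: l2_rel_def)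
  show "symp (l2_rel :: ('a \<Rightarrow> real) \<Rightarrow> _)"
    by (rule sympI) (auto simp: l2_rel_def elim: AE_mp)
  show "transp (l2_rel :: ('a \<Rightarrow> real) \<Rightarrow> _)"
  proof (rule transpI)
    fix f g h :: "'a \<Rightarrow> real"
    assume "l2_rel f g" "l2_rel g h"
    then show "l2_rel f h"
      unfolding l2_rel_def by (auto elim: eventually_elim2)
  qed
qed

instantiation l2 :: (euclidean_space) real_vector
begin

lift_definition zero_l2 :: "'a l2" is "\<lambda>x. 0"
  by (simp add: l2_rel_def square_integrable_zero)

lift_definition plus_l2 :: "'a l2 \<Rightarrow> 'a l2 \<Rightarrow> 'a l2" is "\<lambda>f g x. f x + g x"
  unfolding l2_rel_def by (auto intro: square_integrable_add elim: eventually_elim2)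

lift_definition scaleR_l2 :: "real \<Rightarrow> 'a l2 \<Rightarrow> 'a l2" is "\<lambda>c f x. c * f x"
  unfolding l2_rel_def by (auto intro: square_integrable_scale elim: eventually_mono)

lift_definition uminus_l2 :: "'a l2 \<Rightarrow> 'a l2" is "\<lambda>f x. - f x"
  unfolding l2_rel_def
  by (auto intro: square_integrable_scale[where c = "-1", simplified] elim: eventually_mono)

lift_definition minus_l2 :: "'a l2 \<Rightarrow> 'a l2 \<Rightarrow> 'a l2" is "\<lambda>f g x. f x - g x"
  unfolding l2_rel_def by (auto intro: square_integrable_diff elim: eventually_elim2)

instance
proof
  fix a b :: real and u v w :: "'a l2"
  show "u + v + w = u + (v + w)"
    by transfer (auto simp: l2_rel_def add.assoc intro!: square_integrable_add)
  show "u + v = v + u"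
    by transfer (auto simp: l2_rel_def add.commute intro!: square_integrable_add)
  show "0 + u = u"
    by transfer (auto simp: l2_rel_def)
  show "- u + u = 0"
    by transfer (auto simp: l2_rel_def square_integrable_zero)
  show "u - v = u + - v"
    by transfer (auto simp: l2_rel_def intro: square_integrable_diff)
  show "a *\<^sub>R (u + v) = a *\<^sub>R u + a *\<^sub>R v"
    by transfer (auto simp: l2_rel_def distrib_left
        intro!: square_integrable_add square_integrable_scale)
  show "(a + b) *\<^sub>R u = a *\<^sub>R u + b *\<^sub>R u"
    by transfer (auto simp: l2_rel_def distrib_right
        intro!: square_integrable_add square_integrable_scale)
  show "a *\<^sub>R b *\<^sub>R u = (a * b) *\<^sub>R u"
    by transfer (auto simp: l2_rel_def mult.assoc intro!: square_integrable_scale)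
  show "1 *\<^sub>R u = u"
    by transfer (auto simp: l2_rel_def)
qed

end

instantiation l2 :: (euclidean_space) real_inner
begin

lift_definition inner_l2 :: "'a l2 \<Rightarrow> 'a l2 \<Rightarrow> real" is "\<lambda>f g. \<integral>x. f x * g x \<partial>lebesgue"
proof -
  fix f f' g g' :: "'a \<Rightarrow> real"
  assume ff: "l2_rel f f'" and gg: "l2_rel g g'"
  have "AE x in lebesgue. f x * g x = f' x * g' x"
    using ff gg unfolding l2_rel_def by (auto elim: eventually_elim2)
  moreover have "integrable lebesgue (\<lambda>x. f x * g x)" "integrable lebesgue (\<lambda>x. f' x * g' x)"
    using ff gg by (auto simp: l2_rel_def intro: square_integrable_mult)
  ultimately show "(\<integral>x. f x * g x \<partial>lebesgue) = (\<integral>x. f' x * g' x \<partial>lebesgue)"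
    by (intro integral_cong_AE) (auto dest: borel_measurable_integrable)
qed

definition norm_l2 :: "'a l2 \<Rightarrow> real" where
  "norm_l2 u = sqrt (inner u u)"

definition sgn_l2 :: "'a l2 \<Rightarrow> 'a l2" where
  "sgn_l2 u = u /\<^sub>R norm u"

definition dist_l2 :: "'a l2 \<Rightarrow> 'a l2 \<Rightarrow> real" where
  "dist_l2 u v = norm (u - v)"

definition uniformity_l2 :: "('a l2 \<times> 'a l2) filter" where
  [code del]: "uniformity_l2 = (INF e\<in>{0<..}. principal {(u, v). dist u v < e})"

definition open_l2 :: "'a l2 set \<Rightarrow> bool" where
  [code del]: "open_l2 U \<longleftrightarrow> (\<forall>u\<in>U. \<forall>\<^sub>F (u', v) in uniformity. u' = u \<longrightarrow> v \<in> U)"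

instance
proof
  fix a :: real and u v w :: "'a l2" and U :: "'a l2 set"
  show "norm u = sqrt (inner u u)"
    by (rule norm_l2_def)
  show "sgn u = u /\<^sub>R norm u"
    by (rule sgn_l2_def)
  show "dist u v = norm (u - v)"
    by (rule dist_l2_def)
  show "(uniformity :: ('a l2 \<times> 'a l2) filter) =
      (INF e\<in>{0<..}. principal {(u, v). dist u v < e})"
    by (rule uniformity_l2_def)
  show "open U \<longleftrightarrow> (\<forall>u\<in>U. \<forall>\<^sub>F (u', v) in uniformity. u' = u \<longrightarrow> v \<in> U)"
    by (rule open_l2_def)
  show "inner u v = inner v u"
    by transfer (simp add: mult.commute)
  show "inner (u + v) w = inner u w + inner v w"
    by transfer (simp add: l2_rel_def distrib_right square_integrable_mult)
  show "inner (a *\<^sub>R u) v = a * inner u v"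
    by transfer (simp add: mult.assoc)
  show "0 \<le> inner u u"
    by transfer simp
  show "inner u u = 0 \<longleftrightarrow> u = 0"
  proof transfer
    fix f :: "'a \<Rightarrow> real"
    assume "l2_rel f f"
    then have f: "square_integrable f"
      by (simp add: l2_rel_def)
    have "(\<integral>x. f x * f x \<partial>lebesgue) = 0 \<longleftrightarrow> (AE x in lebesgue. f x * f x = 0)"
      by (rule integral_nonneg_eq_0_iff_AE) (auto intro: square_integrable_mult f)
    then show "(\<integral>x. f x * f x \<partial>lebesgue) = 0 \<longleftrightarrow> l2_rel f (\<lambda>x. 0)"
      by (simp add: l2_rel_def f square_integrable_zero)
  qed
qed

end

text \<open>
  \<open>L\<^sup>2(\<Omega>)\<close> is identified, by extension by zero, with the closed subspace of
  \<open>L\<^sup>2(\<real>\<^sup>d)\<close> of classes vanishing almost everywhere outside \<open>\<Omega>\<close>.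
\<close>

lift_definition vanishes_outside :: "'a::euclidean_space set \<Rightarrow> 'a l2 \<Rightarrow> bool"
  is "\<lambda>\<Omega> f. AE x in lebesgue. x \<notin> \<Omega> \<longrightarrow> f x = 0"
  unfolding l2_rel_def by (auto elim: eventually_elim2)

definition L2_on :: "'a::euclidean_space set \<Rightarrow> 'a l2 set" where
  "L2_on \<Omega> = {u. vanishes_outside \<Omega> u}"

text \<open>Meaningful for open \<open>S\<close>: all iterated partial derivatives up to order \<open>k\<close> are continuous.\<close>

primrec Ck_on :: "nat \<Rightarrow> 'a::euclidean_space set \<Rightarrow> ('a \<Rightarrow> 'b::real_normed_vector) \<Rightarrow> bool" where
  "Ck_on 0 S f \<longleftrightarrow> continuous_on S f"
| "Ck_on (Suc k) S f \<longleftrightarrow> (\<forall>x\<in>S. f differentiable at x) \<and>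
     (\<forall>b\<in>Basis. Ck_on k S (\<lambda>x. frechet_derivative f (at x) b))"

definition smooth_on :: "'a::euclidean_space set \<Rightarrow> ('a \<Rightarrow> 'b::real_normed_vector) \<Rightarrow> bool" where
  "smooth_on S f \<longleftrightarrow> (\<forall>k. Ck_on k S f)"

text \<open>
  Near each boundary point a smooth diffeomorphism \<open>\<psi>\<close> with smooth inverse \<open>\<eta>\<close> maps the part
  inside \<open>\<Omega>\<close> into an open half-space and the boundary onto the bounding hyperplane.
\<close>

definition smooth_boundary :: "'a::euclidean_space set \<Rightarrow> bool" where
  "smooth_boundary \<Omega> \<longleftrightarrow>
     (\<forall>x\<in>frontier \<Omega>. \<exists>U (\<psi> :: 'a \<Rightarrow> 'a) \<eta>. \<exists>b\<in>Basis.
        open U \<and> x \<in> U \<and> open (\<psi> ` U) \<and> smooth_on U \<psi> \<and> smooth_on (\<psi> ` U) \<eta> \<and>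
        (\<forall>y\<in>U. \<eta> (\<psi> y) = y) \<and>
        \<psi> ` (U \<inter> \<Omega>) = \<psi> ` U \<inter> {z. 0 < z \<bullet> b} \<and>
        \<psi> ` (U \<inter> frontier \<Omega>) = \<psi> ` U \<inter> {z. z \<bullet> b = 0})"

definition bounded_smooth_domain :: "'a::euclidean_space set \<Rightarrow> bool" where
  "bounded_smooth_domain \<Omega> \<longleftrightarrow>
     open \<Omega> \<and> connected \<Omega> \<and> \<Omega> \<noteq> {} \<and> bounded \<Omega> \<and> smooth_boundary \<Omega>"

definition test_function :: "'a::euclidean_space set \<Rightarrow> ('a \<Rightarrow> real) \<Rightarrow> bool" where
  "test_function \<Omega> \<phi> \<longleftrightarrow> smooth_on UNIV \<phi> \<and>
     compact (closure {x. \<phi> x \<noteq> 0}) \<and> closure {x. \<phi> x \<noteq> 0} \<subseteq> \<Omega>"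

definition partial_deriv :: "'a::euclidean_space \<Rightarrow> ('a \<Rightarrow> real) \<Rightarrow> 'a \<Rightarrow> real" where
  "partial_deriv b \<phi> x = frechet_derivative \<phi> (at x) b"

definition has_weak_deriv :: "'a::euclidean_space set \<Rightarrow> 'a \<Rightarrow> 'a l2 \<Rightarrow> 'a l2 \<Rightarrow> bool" where
  "has_weak_deriv \<Omega> b u g \<longleftrightarrow> u \<in> L2_on \<Omega> \<and> g \<in> L2_on \<Omega> \<and>
     (\<forall>\<phi>. test_function \<Omega> \<phi> \<longrightarrow> u \<bullet> abs_l2 (partial_deriv b \<phi>) = - (g \<bullet> abs_l2 \<phi>))"

definition weak_deriv :: "'a::euclidean_space set \<Rightarrow> 'a \<Rightarrow> 'a l2 \<Rightarrow> 'a l2" where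
  "weak_deriv \<Omega> b u = (THE g. has_weak_deriv \<Omega> b u g)"

definition sobolev_H1 :: "'a::euclidean_space set \<Rightarrow> 'a l2 set" where
  "sobolev_H1 \<Omega> = {u \<in> L2_on \<Omega>. \<forall>b\<in>Basis. \<exists>g. has_weak_deriv \<Omega> b u g}"

definition sobolev_H2 :: "'a::euclidean_space set \<Rightarrow> 'a l2 set" where
  "sobolev_H2 \<Omega> = {u \<in> sobolev_H1 \<Omega>. \<forall>b\<in>Basis. weak_deriv \<Omega> b u \<in> sobolev_H1 \<Omega>}"

definition sobolev_H1_0 :: "'a::euclidean_space set \<Rightarrow> 'a l2 set" where
  "sobolev_H1_0 \<Omega> = {u \<in> sobolev_H1 \<Omega>. \<exists>\<phi> :: nat \<Rightarrow> 'a \<Rightarrow> real.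
     (\<forall>n. test_function \<Omega> (\<phi> n)) \<and> (\<lambda>n. abs_l2 (\<phi> n)) \<longlonglongrightarrow> u \<and>
     (\<forall>b\<in>Basis. (\<lambda>n. abs_l2 (partial_deriv b (\<phi> n))) \<longlonglongrightarrow> weak_deriv \<Omega> b u)}"

definition dirichlet_dom :: "'a::euclidean_space set \<Rightarrow> 'a l2 set" where
  "dirichlet_dom \<Omega> = sobolev_H2 \<Omega> \<inter> sobolev_H1_0 \<Omega>"

definition dirichlet_laplacian :: "'a::euclidean_space set \<Rightarrow> 'a l2 \<Rightarrow> 'a l2" where
  "dirichlet_laplacian \<Omega> u = - (\<Sum>b\<in>Basis. weak_deriv \<Omega> b (weak_deriv \<Omega> b u))"

text \<open>The eigenvalues and eigenfunctions are numbered from \<open>0\<close>, so \<open>lam 0\<close> is the lowest eigenvalue.\<close>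

definition dirichlet_eigenbasis ::
    "'a::euclidean_space set \<Rightarrow> (nat \<Rightarrow> real) \<Rightarrow> (nat \<Rightarrow> 'a l2) \<Rightarrow> bool" where
  "dirichlet_eigenbasis \<Omega> lam e \<longleftrightarrow>
     (\<forall>i j. e i \<bullet> e j = (if i = j then 1 else 0)) \<and>
     closure (span (range e)) = L2_on \<Omega> \<and>
     (\<forall>j. e j \<in> dirichlet_dom \<Omega> \<and> dirichlet_laplacian \<Omega> (e j) = lam j *\<^sub>R e j) \<and>
     0 < lam 0 \<and> mono lam \<and> filterlim lam at_top sequentially"

text \<open>
  \<open>spectral_op e f\<close> is the operator acting diagonally on the orthonormal basis \<open>e\<close> of \<open>H\<close> with
  multipliers \<open>f j\<close>; it is meaningful on its maximal domain \<open>spectral_dom H e f\<close>.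
\<close>

definition spectral_dom :: "'h::real_inner set \<Rightarrow> (nat \<Rightarrow> 'h) \<Rightarrow> (nat \<Rightarrow> real) \<Rightarrow> 'h set" where
  "spectral_dom H e f = {u \<in> H. summable (\<lambda>j. (f j)\<^sup>2 * (u \<bullet> e j)\<^sup>2)}"

definition spectral_op :: "(nat \<Rightarrow> 'h::real_inner) \<Rightarrow> (nat \<Rightarrow> real) \<Rightarrow> 'h \<Rightarrow> 'h" where
  "spectral_op e f u = (\<Sum>j. (f j * (u \<bullet> e j)) *\<^sub>R e j)"

definition graph_norm :: "(nat \<Rightarrow> 'h::real_inner) \<Rightarrow> (nat \<Rightarrow> real) \<Rightarrow> 'h \<Rightarrow> real" where
  "graph_norm e f u = sqrt ((norm u)\<^sup>2 + (norm (spectral_op e f u))\<^sup>2)"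

definition poly_spec :: "real poly \<Rightarrow> (nat \<Rightarrow> real) \<Rightarrow> nat \<Rightarrow> real" where
  "poly_spec P lam j = poly P (lam j)"

definition power_spec :: "real poly \<Rightarrow> real \<Rightarrow> (nat \<Rightarrow> real) \<Rightarrow> real \<Rightarrow> nat \<Rightarrow> real" where
  "power_spec P \<kappa> lam \<theta> j = (poly P (lam j) + \<kappa>) powr \<theta>"

text \<open>\<open>LEAST\<close> over the reals is the minimum; it is meaningful only when the minimum is attained.\<close>

definition min_poly_from :: "real poly \<Rightarrow> real \<Rightarrow> real" where
  "min_poly_from P a = (LEAST y. y \<in> poly P ` {a..})"

definition unit_sphere :: "'h::real_inner set \<Rightarrow> 'h set" where
  "unit_sphere H = {u \<in> H. norm u = 1}"

definition tangent_proj :: "'h::real_inner \<Rightarrow> 'h \<Rightarrow> 'h" where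
  "tangent_proj u v = v - (v \<bullet> u) *\<^sub>R u"

text \<open>
  Solutions of \<open>\<partial>\<^sub>t u = - \<Pi>\<^sub>u P(B) u\<close>, \<open>u(0) = u0\<close>, with values in the unit sphere of \<open>H\<close>, in
  \<open>C([0,\<infinity>); H) \<inter> C((0,\<infinity>); D(P(B))) \<inter> C\<^sup>1((0,\<infinity>); H)\<close>; \<open>p\<close> is the sequence of
  multipliers of \<open>P(B)\<close>. Values at negative times are irrelevant.
\<close>

definition normalized_flow ::
    "'h::real_inner set \<Rightarrow> (nat \<Rightarrow> 'h) \<Rightarrow> (nat \<Rightarrow> real) \<Rightarrow> 'h \<Rightarrow> (real \<Rightarrow> 'h) \<Rightarrow> bool" where
  "normalized_flow H e p u0 u \<longleftrightarrow>
     u 0 = u0 \<and>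
     (\<forall>t\<ge>0. u t \<in> unit_sphere H) \<and>
     continuous_on {0..} u \<and>
     (\<forall>t>0. u t \<in> spectral_dom H e p \<and>
        ((\<lambda>s. graph_norm e p (u s - u t)) \<longlongrightarrow> 0) (at t)) \<and>
     (\<exists>u'. continuous_on {0<..} u' \<and>
        (\<forall>t>0. (u has_vector_derivative u' t) (at t) \<and>
           u' t = - tangent_proj (u t) (spectral_op e p (u t))))"

definition active_spectrum :: "(nat \<Rightarrow> 'h::real_inner) \<Rightarrow> (nat \<Rightarrow> real) \<Rightarrow> 'h \<Rightarrow> real set" where
  "active_spectrum e p u0 = {p j | j. u0 \<bullet> e j \<noteq> 0}"

definition active_min :: "(nat \<Rightarrow> 'h::real_inner) \<Rightarrow> (nat \<Rightarrow> real) \<Rightarrow> 'h \<Rightarrow> real" where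
  "active_min e p u0 = (LEAST \<mu>. \<mu> \<in> active_spectrum e p u0)"

definition active_gap :: "(nat \<Rightarrow> 'h::real_inner) \<Rightarrow> (nat \<Rightarrow> real) \<Rightarrow> 'h \<Rightarrow> real" where
  "active_gap e p u0 =
     (LEAST d. d \<in> {\<mu> - active_min e p u0 | \<mu>. \<mu> \<in> active_spectrum e p u0 \<and> active_min e p u0 < \<mu>})"

definition eigenspace ::
    "'h::real_inner set \<Rightarrow> (nat \<Rightarrow> 'h) \<Rightarrow> (nat \<Rightarrow> real) \<Rightarrow> real \<Rightarrow> 'h set" where
  "eigenspace H e p \<mu> = {v \<in> spectral_dom H e p. spectral_op e p v - \<mu> *\<^sub>R v = 0}"

definition orth_proj :: "'h::real_inner set \<Rightarrow> 'h \<Rightarrow> 'h" where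
  "orth_proj V v = (THE w. w \<in> V \<and> (\<forall>z\<in>V. (v - w) \<bullet> z = 0))"

definition flow_limit :: "'h::real_inner set \<Rightarrow> (nat \<Rightarrow> 'h) \<Rightarrow> (nat \<Rightarrow> real) \<Rightarrow> 'h \<Rightarrow> 'h" where
  "flow_limit H e p u0 =
     (let w = orth_proj (eigenspace H e p (active_min e p u0)) u0 in w /\<^sub>R norm w)"

end

theory Submission
  imports Defs "HOL-Real_Asymp.Real_Asymp"
begin

text \<open>
  Everything is read off in the eigenbasis. Write \<open>u\<^sub>j\<close> for the \<open>j\<close>-th coefficient and \<open>p\<^sub>j\<close> for the
  \<open>j\<close>-th eigenvalue of the operator \<open>P(B)\<close>. Along a solution every coefficient satisfies
  \<open>u\<^sub>j' = (m(t) - p\<^sub>j) u\<^sub>j\<close>, where \<open>m(t)\<close> is the Rayleigh quotient of \<open>u(t)\<close>; only \<open>m\<close> couples the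
  coordinates, and it is the same for all of them. Hence the quotients of two of the functions
  \<open>exp(p\<^sub>j t) u\<^sub>j(t)\<close> do not change in time, and
  \<open>u\<^sub>j(t) = \<rho>(t) exp(-p\<^sub>j t) u\<^sub>j(0)\<close> with one positive factor \<open>\<rho>(t)\<close>. This is lemma
  \<open>normalized_flow_coeff\<close>; it recovers the explicit solution, and its uniqueness, from the
  differential equation.

  Let \<open>\<mu>\<close> be the smallest active eigenvalue, \<open>w\<close> the projection of the datum to its eigenspace, and
  put \<open>D(t) = exp(\<mu> t) / \<rho>(t)\<close>, which is the norm of the vector with coefficients
  \<open>exp(-(p\<^sub>j - \<mu>) t) u\<^sub>j(0)\<close>. The coefficients of \<open>u(t) - w/\<parallel>w\<parallel>\<close> are \<open>(1/D - 1/\<parallel>w\<parallel>) u\<^sub>j(0)\<close> on the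
  eigenspace of \<open>\<mu>\<close>, where \<open>D\<^sup>2 - \<parallel>w\<parallel>\<^sup>2\<close> is exponentially small because it only collects the other
  active modes, and \<open>exp(-(p\<^sub>j - \<mu>) t) u\<^sub>j(0) / D\<close> off it. In the latter, the factor at time \<open>\<tau>\<close>
  absorbs the multiplier of the fractional power, since \<open>(p\<^sub>j + \<kappa>)\<^sup>\<theta> exp(-p\<^sub>j \<tau>)\<close> is bounded in
  \<open>j\<close>, and the remaining time \<open>t - \<tau>\<close> yields \<open>exp(-\<delta> (t - \<tau>))\<close>. So each coefficient of the
  difference, weighted by the multiplier, is at most a constant times \<open>exp(-\<delta> t) \<bar>u\<^sub>j(0)\<bar>\<close>
  (lemma \<open>normalized_flow_decay\<close>), and Parseval turns this into the norm estimate. Here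
  \<open>\<delta>\<close> is the gap if there is one, and any positive number if there is a single active value, so
  that convergence follows in both cases.

  The operators are defined by orthogonal series, so knowing their coefficients requires these
  series to converge. That is the Riesz--Fischer theorem: \<open>L\<^sup>2\<close> is complete.
\<close>

section \<open>Completeness of the space of square integrable functions\<close>

lemma square_integrable_rep: "square_integrable (rep_l2 u)"
  using Quotient3_rep_reflp[OF Quotient3_l2, of u] by (simp add: l2_rel_def)

text \<open>
  The extended nonnegative integral is the form of the \<open>L\<^sup>2\<close> distance to which monotone
  convergence and Fatou's lemma apply without a prior integrability proof.
\<close>

lemma norm_abs_l2_diff:
  assumes "square_integrable f" "square_integrable g"
  shows "ennreal ((norm (abs_l2 f - abs_l2 g))\<^sup>2) = (\<integral>\<^sup>+x. ennreal ((f x - g x)\<^sup>2) \<partial>lebesgue)"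
proof -
  have d: "square_integrable (\<lambda>x. f x - g x)"
    using assms by (rule square_integrable_diff)
  have "abs_l2 f - abs_l2 g = abs_l2 (\<lambda>x. f x - g x)"
    using assms by (simp add: minus_l2.abs_eq l2_rel_def)
  then have "(norm (abs_l2 f - abs_l2 g))\<^sup>2 = (\<integral>x. (f x - g x)\<^sup>2 \<partial>lebesgue)"
    using d unfolding power2_norm_eq_inner
    by (simp add: inner_l2.abs_eq l2_rel_def power2_eq_square)
  with d show ?thesis
    by (simp add: nn_integral_eq_integral square_integrable_def)
qed

text \<open>
  If the increments are small enough, the series of \<open>2\<^sup>k\<close> times their squares has a finite
  integral, so it converges almost everywhere. Since \<open>\<bar>y\<bar> \<le> 2\<^sup>k y\<^sup>2 + 2\<^sup>-\<^sup>k\<close>, the increments themselves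
  are then summable almost everywhere; this avoids Minkowski's inequality.
\<close>

lemma square_integrable_fast_Cauchy_AE_convergent:
  fixes F :: "nat \<Rightarrow> 'a::euclidean_space \<Rightarrow> real"
  assumes F: "\<And>k. square_integrable (F k)"
    and fast: "\<And>k. (\<integral>\<^sup>+x. ennreal ((F (Suc k) x - F k x)\<^sup>2) \<partial>lebesgue) \<le> ennreal ((1/4) ^ k)"
  shows "AE x in lebesgue. convergent (\<lambda>k. F k x)"
proof -
  define d where "d k x = 2 ^ k * (F (Suc k) x - F k x)\<^sup>2" for k x
  have [measurable]: "F k \<in> borel_measurable lebesgue" for k
    using F by (simp add: square_integrable_def)
  have [measurable]: "d k \<in> borel_measurable lebesgue" for k
    unfolding d_def by measurable
  have "(\<integral>\<^sup>+x. ennreal (d k x) \<partial>lebesgue) \<le> ennreal ((1/2) ^ k)" for k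
  proof -
    have "(\<integral>\<^sup>+x. ennreal (d k x) \<partial>lebesgue)
        = ennreal (2 ^ k) * (\<integral>\<^sup>+x. ennreal ((F (Suc k) x - F k x)\<^sup>2) \<partial>lebesgue)"
      by (simp add: d_def ennreal_mult nn_integral_cmult)
    also have "\<dots> \<le> ennreal (2 ^ k) * ennreal ((1/4) ^ k)"
      by (intro mult_left_mono fast) simp
    also have "\<dots> = ennreal ((1/2) ^ k)"
      by (simp add: ennreal_mult[symmetric] power_mult_distrib[symmetric])
    finally show ?thesis .
  qed
  then have "(\<integral>\<^sup>+x. (\<Sum>k. ennreal (d k x)) \<partial>lebesgue) \<le> (\<Sum>k. ennreal ((1/2) ^ k))"
    by (subst nn_integral_suminf) (auto intro!: suminf_le)
  also have "\<dots> < \<infinity>"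
    by (subst suminf_ennreal2) (auto simp: summable_geometric)
  finally have "AE x in lebesgue. (\<Sum>k. ennreal (d k x)) \<noteq> \<infinity>"
    by (intro nn_integral_PInf_AE) auto
  then show ?thesis
  proof eventually_elim
    case (elim x)
    then have "summable (\<lambda>k. d k x)"
      by (intro summable_suminf_not_top) (auto simp: d_def)
    then have sm: "summable (\<lambda>k. d k x + (1/2) ^ k)"
      by (intro summable_add summable_geometric) auto
    have "summable (\<lambda>k. F (Suc k) x - F k x)"
    proof (rule summable_comparison_test'[OF sm])
      fix k
      define y where "y = F (Suc k) x - F k x"
      have "z \<le> z\<^sup>2 + 1" if "0 \<le> z" for z :: real
        using zero_le_power2[of "z - 1"] that by (simp add: power2_diff)
      then have "2 ^ k * \<bar>y\<bar> \<le> (2 ^ k * \<bar>y\<bar>)\<^sup>2 + 1"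
        by simp
      also have "\<dots> = 2 ^ k * (2 ^ k * y\<^sup>2 + (1/2) ^ k)"
        by (simp add: power2_eq_square algebra_simps power_mult_distrib[symmetric])
      finally show "norm (F (Suc k) x - F k x) \<le> d k x + (1/2) ^ k"
        by (simp add: d_def y_def)
    qed
    then have "convergent (\<lambda>n. F n x - F 0 x)"
      by (simp add: summable_iff_convergent sum_lessThan_telescope[of "\<lambda>i. F i x"])
    then have "convergent (\<lambda>n. (F n x - F 0 x) + F 0 x)"
      by (intro convergent_add convergent_const)
    then show ?case by simp
  qed
qed

text \<open>
  A Cauchy sequence has a subsequence with increments as small as the previous lemma asks for. Its
  almost everywhere limit is square integrable and is the \<open>L\<^sup>2\<close> limit by Fatou's lemma, applied to
  the squared distances from a fixed member of the subsequence.
\<close>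

instance l2 :: (euclidean_space) banach
proof
  fix X :: "nat \<Rightarrow> 'a l2"
  assume X: "Cauchy X"
  have "\<exists>N. \<forall>m\<ge>N. \<forall>n\<ge>N. dist (X m) (X n) < (1/2) ^ k" for k
    using X by (intro metric_CauchyD) auto
  then obtain N where N: "\<And>k m n. m \<ge> N k \<Longrightarrow> n \<ge> N k \<Longrightarrow> dist (X m) (X n) < (1/2) ^ k"
    by metis
  \<comment> \<open>The sum makes \<open>r k \<ge> N k\<close> hold for an \<open>N\<close> that need not be monotone, the summand \<open>k\<close> makes \<open>r\<close> strict.\<close>
  define r where "r k = k + (\<Sum>i\<le>k. N i)" for k
  have r: "strict_mono r"
    by (rule strict_monoI_Suc) (simp add: r_def)
  have rN: "N k \<le> r k" for k
    unfolding r_def using member_le_sum[of k "{..k}" N] by simp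
  define F where "F k = rep_l2 (X (r k))" for k
  have F: "square_integrable (F k)" for k
    by (simp add: F_def square_integrable_rep)
  then have [measurable]: "F k \<in> borel_measurable lebesgue" for k
    by (simp add: square_integrable_def)
  have XF: "X (r k) = abs_l2 (F k)" for k
    by (simp add: F_def Quotient3_abs_rep[OF Quotient3_l2])
  have dF: "(\<integral>\<^sup>+x. ennreal ((F j x - F k x)\<^sup>2) \<partial>lebesgue) \<le> ennreal ((1/4) ^ k)" if "k \<le> j" for j k
  proof -
    have "r k \<le> r j" using r that by (simp add: strict_mono_less_eq)
    then have "norm (X (r j) - X (r k)) \<le> (1/2) ^ k"
      using N[of k "r j" "r k"] rN[of k] by (simp add: dist_norm)
    then have "(norm (X (r j) - X (r k)))\<^sup>2 \<le> ((1/2) ^ k)\<^sup>2"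
      by (intro power_mono) auto
    also have "\<dots> = (1/4) ^ k"
      by (simp add: power2_eq_square power_mult_distrib[symmetric])
    finally show ?thesis
      using norm_abs_l2_diff[OF F F, of j k] by (simp add: XF ennreal_leI flip: norm_abs_l2_diff[OF F F])
  qed
  define f where "f x = lim (\<lambda>k. F k x)" for x
  have conv: "AE x in lebesgue. convergent (\<lambda>k. F k x)"
    using F dF by (intro square_integrable_fast_Cauchy_AE_convergent) auto
  have [measurable]: "f \<in> borel_measurable lebesgue"
    unfolding f_def by measurable
  have df: "(\<integral>\<^sup>+x. ennreal ((f x - F k x)\<^sup>2) \<partial>lebesgue) \<le> ennreal ((1/4) ^ k)" for k
  proof -
    have "(\<integral>\<^sup>+x. ennreal ((f x - F k x)\<^sup>2) \<partial>lebesgue)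
        = (\<integral>\<^sup>+x. liminf (\<lambda>j. ennreal ((F j x - F k x)\<^sup>2)) \<partial>lebesgue)"
    proof (rule nn_integral_cong_AE, use conv in eventually_elim)
      case (elim x)
      then have "(\<lambda>j. ennreal ((F j x - F k x)\<^sup>2)) \<longlonglongrightarrow> ennreal ((f x - F k x)\<^sup>2)"
        unfolding f_def by (intro tendsto_intros) (simp add: convergent_LIMSEQ_iff)
      then show ?case by (intro lim_imp_Liminf[symmetric]) auto
    qed
    also have "\<dots> \<le> liminf (\<lambda>j. \<integral>\<^sup>+x. ennreal ((F j x - F k x)\<^sup>2) \<partial>lebesgue)"
      by (rule nn_integral_liminf) simp
    also have "\<dots> \<le> ennreal ((1/4) ^ k)"
      by (rule Liminf_le) (auto intro!: eventually_sequentiallyI[of k] dF)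
    finally show ?thesis .
  qed
  have "integrable lebesgue (\<lambda>x. (f x - F 0 x)\<^sup>2)"
    by (rule integrableI_nonneg) (use df[of 0] in \<open>auto simp: le_less_trans\<close>)
  then have "square_integrable (\<lambda>x. f x - F 0 x)"
    by (simp add: square_integrable_def)
  from square_integrable_add[OF this F[of 0]] have f: "square_integrable f"
    by simp
  have nf: "norm (X (r k) - abs_l2 f) \<le> (1/2) ^ k" for k
  proof -
    have "ennreal ((norm (abs_l2 f - X (r k)))\<^sup>2) \<le> ennreal ((1/4) ^ k)"
      using df[of k] by (simp add: XF norm_abs_l2_diff[OF f F])
    also have "(1/4::real) ^ k = ((1/2) ^ k)\<^sup>2"
      by (simp add: power2_eq_square power_mult_distrib[symmetric])
    finally show ?thesis
      by (simp add: norm_minus_commute ennreal_le_iff power_mono_iff)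
  qed
  have "(\<lambda>k. X (r k) - abs_l2 f) \<longlonglongrightarrow> 0"
    using nf by (intro Lim_null_comparison[OF always_eventually LIMSEQ_power_zero[of "1/2::real"]]) auto
  then have "(X \<circ> r) \<longlonglongrightarrow> abs_l2 f"
    by (simp add: o_def LIM_zero_iff)
  with X r show "convergent X"
    by (auto simp: convergent_def intro: Cauchy_converges_subseq)
qed

section \<open>Orthonormal bases and diagonal operators\<close>

text \<open>
  The space \<open>H\<close> is a closed subspace of the ambient Hilbert space, as \<open>L\<^sup>2(\<Omega>)\<close> is in \<open>L\<^sup>2(\<real>\<^sup>d)\<close>.
  Vectors outside \<open>H\<close> also have coefficients, but are not determined by them.
\<close>

locale orthonormal_basis =
  fixes H :: "'h::{real_inner, banach} set" and e :: "nat \<Rightarrow> 'h"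
  assumes orthonormal: "e i \<bullet> e j = (if i = j then 1 else 0)"
    and closure_span: "closure (span (range e)) = H"
begin

lemma norm_sum_orthonormal:
  assumes "finite A"
  shows "(norm (\<Sum>j\<in>A. a j *\<^sub>R e j))\<^sup>2 = (\<Sum>j\<in>A. (a j)\<^sup>2)"
  using assms unfolding power2_norm_eq_inner
  by (simp add: inner_sum_left inner_sum_right orthonormal power2_eq_square if_distrib sum.delta
      cong: if_cong)

lemma summable_orthonormal:
  assumes "summable (\<lambda>j. (a j)\<^sup>2)"
  shows "summable (\<lambda>j. a j *\<^sub>R e j)"
  unfolding summable_Cauchy
proof (intro allI impI)
  fix \<epsilon> :: real
  assume "0 < \<epsilon>"
  then have "0 < \<epsilon>\<^sup>2" by simp
  with assms obtain N where "\<And>m n. m \<ge> N \<Longrightarrow> norm (\<Sum>j\<in>{m..<n}. (a j)\<^sup>2) < \<epsilon>\<^sup>2"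
    unfolding summable_Cauchy by blast
  then have "(norm (\<Sum>j\<in>{m..<n}. a j *\<^sub>R e j))\<^sup>2 < \<epsilon>\<^sup>2" if "m \<ge> N" for m n
    using that by (force simp: norm_sum_orthonormal sum_nonneg)
  then show "\<exists>N. \<forall>m\<ge>N. \<forall>n. norm (\<Sum>j\<in>{m..<n}. a j *\<^sub>R e j) < \<epsilon>"
    using \<open>0 < \<epsilon>\<close> by (meson power_less_imp_less_base less_imp_le)
qed

lemma suminf_orthonormal_in_H:
  assumes "summable (\<lambda>j. (a j)\<^sup>2)"
  shows "(\<Sum>j. a j *\<^sub>R e j) \<in> H"
proof -
  have "(\<lambda>n. \<Sum>j<n. a j *\<^sub>R e j) \<longlonglongrightarrow> (\<Sum>j. a j *\<^sub>R e j)"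
    using summable_LIMSEQ[OF summable_orthonormal[OF assms]] .
  moreover have "(\<Sum>j<n. a j *\<^sub>R e j) \<in> span (range e)" for n
    by (intro span_sum span_scale span_base) auto
  ultimately show ?thesis
    unfolding closure_span[symmetric] by (metis (mono_tags, lifting) closure_sequential)
qed

lemma coeff_suminf_orthonormal:
  assumes "summable (\<lambda>j. (a j)\<^sup>2)"
  shows "(\<Sum>j. a j *\<^sub>R e j) \<bullet> e k = a k"
proof -
  have "(\<lambda>j. (a j *\<^sub>R e j) \<bullet> e k) sums ((\<Sum>j. a j *\<^sub>R e j) \<bullet> e k)"
    by (intro bounded_linear.sums[OF bounded_linear_inner_left]
        summable_sums[OF summable_orthonormal[OF assms]])
  moreover have "(\<lambda>j. (a j *\<^sub>R e j) \<bullet> e k) = (\<lambda>j. if j = k then a j else 0)"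
    by (auto simp: orthonormal)
  ultimately show ?thesis
    using sums_single[of k a] by (metis sums_unique2)
qed

lemma norm_suminf_orthonormal:
  assumes "summable (\<lambda>j. (a j)\<^sup>2)"
  shows "(norm (\<Sum>j. a j *\<^sub>R e j))\<^sup>2 = (\<Sum>j. (a j)\<^sup>2)"
proof -
  let ?v = "\<Sum>j. a j *\<^sub>R e j"
  have "(\<lambda>j. ?v \<bullet> (a j *\<^sub>R e j)) sums (?v \<bullet> ?v)"
    by (intro bounded_linear.sums[OF bounded_linear_inner_right]
        summable_sums[OF summable_orthonormal[OF assms]])
  then show ?thesis
    unfolding power2_norm_eq_inner
    by (simp add: coeff_suminf_orthonormal[OF assms] sums_iff power2_eq_square)
qed

text \<open>The vectors orthogonal to a fixed one form a closed subspace.\<close>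

lemma orthogonal_H:
  assumes "\<And>j. w \<bullet> e j = 0" "v \<in> H"
  shows "w \<bullet> v = 0"
proof -
  have "span (range e) \<subseteq> {v. w \<bullet> v = 0}"
    by (rule span_minimal) (use assms(1) in \<open>auto simp: subspace_hyperplane\<close>)
  then have "H \<subseteq> {v. w \<bullet> v = 0}"
    unfolding closure_span[symmetric] by (intro closure_minimal closed_hyperplane)
  with assms(2) show ?thesis by auto
qed

text \<open>
  Bessel's inequality: the partial sum is the orthogonal projection of \<open>v\<close>, hence no longer than
  \<open>v\<close>.
\<close>

lemma summable_coeff: "summable (\<lambda>j. (v \<bullet> e j)\<^sup>2)"
proof (rule summableI_nonneg_bounded)
  fix n
  let ?s = "\<Sum>j<n. (v \<bullet> e j) *\<^sub>R e j"
  have "v \<bullet> ?s = (\<Sum>j<n. (v \<bullet> e j)\<^sup>2)"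
    by (simp add: inner_sum_right power2_eq_square)
  moreover have "0 \<le> (v - ?s) \<bullet> (v - ?s)"
    by simp
  ultimately show "(\<Sum>j<n. (v \<bullet> e j)\<^sup>2) \<le> (norm v)\<^sup>2"
    using norm_sum_orthonormal[of "{..<n}" "\<lambda>j. v \<bullet> e j"]
    by (simp add: power2_norm_eq_inner inner_diff_left inner_diff_right inner_commute[of ?s v])
qed simp

lemma expansion:
  assumes "v \<in> H"
  shows "(\<Sum>j. (v \<bullet> e j) *\<^sub>R e j) = v"
proof -
  let ?w = "\<Sum>j. (v \<bullet> e j) *\<^sub>R e j"
  have *: "(v - ?w) \<bullet> e j = 0" for j
    by (simp add: inner_diff_left coeff_suminf_orthonormal summable_coeff)
  have "(v - ?w) \<bullet> v = 0" "(v - ?w) \<bullet> ?w = 0"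
    using orthogonal_H[OF *] assms suminf_orthonormal_in_H[OF summable_coeff] by auto
  then have "(v - ?w) \<bullet> (v - ?w) = 0"
    by (simp add: inner_diff_right)
  then show ?thesis by simp
qed

lemma Parseval:
  assumes "v \<in> H"
  shows "(\<lambda>j. (v \<bullet> e j)\<^sup>2) sums (norm v)\<^sup>2"
  using norm_suminf_orthonormal[OF summable_coeff, of v] expansion[OF assms]
  by (simp add: sums_iff summable_coeff)

lemma unit_vector_nonzero_coeff:
  assumes "v \<in> H" "norm v = 1"
  shows "\<exists>j. v \<bullet> e j \<noteq> 0"
proof (rule ccontr)
  assume "\<nexists>j. v \<bullet> e j \<noteq> 0"
  then have "v \<bullet> v = 0"
    using orthogonal_H[of v v] assms(1) by blast
  with assms(2) show False by simp
qed

lemma scaleR_in_H: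
  assumes "v \<in> H"
  shows "c *\<^sub>R v \<in> H"
proof -
  have sm: "summable (\<lambda>j. (c * (v \<bullet> e j))\<^sup>2)"
    using summable_mult[OF summable_coeff[of v], of "c\<^sup>2"] by (simp only: power_mult_distrib)
  have "(\<Sum>j. (c * (v \<bullet> e j)) *\<^sub>R e j) = c *\<^sub>R (\<Sum>j. (v \<bullet> e j) *\<^sub>R e j)"
    by (subst suminf_scaleR_right) (simp_all add: summable_orthonormal summable_coeff)
  then show ?thesis
    using suminf_orthonormal_in_H[OF sm] by (simp add: expansion[OF assms])
qed

lemma coeff_spectral_op:
  assumes "v \<in> spectral_dom H e f"
  shows "spectral_op e f v \<bullet> e j = f j * (v \<bullet> e j)"
  using assms coeff_suminf_orthonormal[of "\<lambda>j. f j * (v \<bullet> e j)"]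
  by (simp add: spectral_op_def spectral_dom_def power_mult_distrib)

text \<open>
  This turns an estimate of coefficients that is uniform in \<open>j\<close> into membership in the domain and
  a norm bound; all the estimates of the flow are made coefficient by coefficient because of it.
\<close>

lemma spectral_op_dominated:
  assumes y: "y \<in> H" and K: "0 \<le> K"
    and le: "\<And>j. \<bar>f j * (x \<bullet> e j)\<bar> \<le> K * \<bar>y \<bullet> e j\<bar>"
  shows "summable (\<lambda>j. (f j)\<^sup>2 * (x \<bullet> e j)\<^sup>2)"
    and "norm (spectral_op e f x) \<le> K * norm y"
proof -
  have le2: "(f j * (x \<bullet> e j))\<^sup>2 \<le> K\<^sup>2 * (y \<bullet> e j)\<^sup>2" for j
    using power_mono[OF le[of j], of 2] by (simp add: power_mult_distrib)
  have sm: "summable (\<lambda>j. K\<^sup>2 * (y \<bullet> e j)\<^sup>2)"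
    by (intro summable_mult summable_coeff)
  have s: "summable (\<lambda>j. (f j * (x \<bullet> e j))\<^sup>2)"
    by (rule summable_comparison_test'[OF sm]) (use le2 in simp)
  then show "summable (\<lambda>j. (f j)\<^sup>2 * (x \<bullet> e j)\<^sup>2)"
    by (simp add: power_mult_distrib)
  have "(norm (spectral_op e f x))\<^sup>2 = (\<Sum>j. (f j * (x \<bullet> e j))\<^sup>2)"
    unfolding spectral_op_def using s by (rule norm_suminf_orthonormal)
  also have "\<dots> \<le> (\<Sum>j. K\<^sup>2 * (y \<bullet> e j)\<^sup>2)"
    by (rule suminf_le[OF le2 s sm])
  also have "\<dots> = (K * norm y)\<^sup>2"
    using Parseval[OF y] sums_mult[OF Parseval[OF y], of "K\<^sup>2"]
    by (simp add: sums_iff power_mult_distrib)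
  finally show "norm (spectral_op e f x) \<le> K * norm y"
    by (rule power2_le_imp_le) (simp add: K)
qed

section \<open>The normalized flow in coordinates\<close>

text \<open>
  Put \<open>g\<^sub>j(t) = exp(p\<^sub>j t) u\<^sub>j(t)\<close>. All \<open>g\<^sub>j\<close> solve the same scalar equation \<open>g' = m g\<close>, so
  \<open>g\<^sub>j / g\<^sub>k\<close> is constant as long as \<open>g\<^sub>k\<close> does not vanish. Choose \<open>k\<close> with \<open>g\<^sub>k(0) \<noteq> 0\<close>. At a first
  zero of \<open>g\<^sub>k\<close> all the \<open>g\<^sub>j\<close> would vanish, which is impossible for a unit vector; so \<open>g\<^sub>k\<close> has no zero
  and keeps its sign. The rate \<open>m\<close> may be unbounded near time \<open>0\<close>, where the datum is only in \<open>H\<close>: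
  the quotients reach the initial time by continuity of \<open>u\<close>, with no integral of \<open>m\<close>.
\<close>

lemma normalized_flow_coeff:
  assumes flow: "normalized_flow H e p u0 u"
  obtains \<rho> where "\<And>t. t > 0 \<Longrightarrow> \<rho> t > 0"
    and "\<And>t j. t > 0 \<Longrightarrow> u t \<bullet> e j = \<rho> t * exp (- p j * t) * (u0 \<bullet> e j)"
proof -
  define g where "g j t = exp (p j * t) * (u t \<bullet> e j)" for j t
  have u0: "u 0 = u0" and uH: "\<And>t. t \<ge> 0 \<Longrightarrow> u t \<in> H \<and> norm (u t) = 1"
    and cu: "continuous_on {0..} u" and dom: "\<And>t. t > 0 \<Longrightarrow> u t \<in> spectral_dom H e p"
    using flow by (simp_all add: normalized_flow_def unit_sphere_def)
  obtain u' where u': "\<forall>t>0. (u has_vector_derivative u' t) (at t) \<and>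
      u' t = - tangent_proj (u t) (spectral_op e p (u t))"
    using flow unfolding normalized_flow_def by blast
  have du: "(u has_vector_derivative - tangent_proj (u t) (spectral_op e p (u t))) (at t)"
    if "t > 0" for t
    using u'[rule_format, OF that] by (elim conjE) (simp only:)
  have nonzero: "\<exists>j. u t \<bullet> e j \<noteq> 0" if "t \<ge> 0" for t
    using unit_vector_nonzero_coeff[of "u t"] uH[OF that] by auto
  obtain k where k: "u0 \<bullet> e k \<noteq> 0"
    using nonzero[of 0] u0 by auto
  have cg: "continuous_on {0..} (g j)" for j
    unfolding g_def by (intro continuous_intros cu)
  have dg: "(g j has_real_derivative (spectral_op e p (u t) \<bullet> u t) * g j t) (at t)"
    if "t > 0" for j t
  proof -
    have "((\<lambda>t. u t \<bullet> e j) has_vector_derivative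
        (- tangent_proj (u t) (spectral_op e p (u t))) \<bullet> e j) (at t)"
      by (rule bounded_linear.has_vector_derivative[OF bounded_linear_inner_left du[OF that]])
    then have "((\<lambda>t. u t \<bullet> e j) has_real_derivative
        (spectral_op e p (u t) \<bullet> u t - p j) * (u t \<bullet> e j)) (at t)"
      by (simp add: has_real_derivative_iff_has_vector_derivative tangent_proj_def
          inner_diff_left coeff_spectral_op[OF dom[OF that]] algebra_simps)
    then show ?thesis
      unfolding g_def by (auto intro!: derivative_eq_intros simp: algebra_simps)
  qed
  have ratio: "g j T * g k 0 = g j 0 * g k T"
    if "T > 0" and nz: "\<And>t. 0 \<le> t \<Longrightarrow> t < T \<Longrightarrow> g k t \<noteq> 0" for j T
  proof -
    have eq: "g j s * g k 0 - g j 0 * g k s = 0" if s: "s \<in> {0..<T}" for s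
    proof (cases "s = 0")
      case False
      have nz': "g k t \<noteq> 0" if "t \<in> {0..s}" for t
        using nz[of t] that s by auto
      have "g j s / g k s = g j 0 / g k 0"
      proof (rule DERIV_isconst_end[where f = "\<lambda>t. g j t / g k t"])
        show "continuous_on {0..s} (\<lambda>t. g j t / g k t)"
          by (intro continuous_intros continuous_on_subset[OF cg]) (use nz' in auto)
        show "((\<lambda>t. g j t / g k t) has_real_derivative 0) (at t)" if "0 < t" "t < s" for t
          using nz'[of t] that by (auto intro!: derivative_eq_intros dg)
      qed (use False s in auto)
      then show ?thesis
        using nz'[of 0] nz'[of s] s by (simp add: field_simps)
    qed simp
    have "g j T * g k 0 - g j 0 * g k T = 0"
    proof (rule continuous_constant_on_closure[where S = "{0..<T}" and
          f = "\<lambda>s. g j s * g k 0 - g j 0 * g k s"])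
      show "continuous_on (closure {0..<T}) (\<lambda>s. g j s * g k 0 - g j 0 * g k s)"
        using \<open>T > 0\<close> by (intro continuous_intros continuous_on_subset[OF cg]) auto
    qed (use eq \<open>T > 0\<close> in auto)
    then show ?thesis by simp
  qed
  have nz: "g k t \<noteq> 0" if "t \<ge> 0" for t
  proof
    assume "g k t = 0"
    define Z where "Z = {s \<in> {0..}. g k s = 0}"
    have "Z \<noteq> {}" "bdd_below Z" "closed Z"
      using \<open>g k t = 0\<close> that continuous_closed_preimage_constant[OF cg[of k], of 0]
      by (auto simp: Z_def)
    then have T: "Inf Z \<in> Z"
      by (rule closed_contains_Inf)
    have "Inf Z > 0"
      using T k u0 by (auto simp: Z_def g_def less_le)
    moreover have "g k s \<noteq> 0" if "0 \<le> s" "s < Inf Z" for s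
      using cInf_lower[OF _ \<open>bdd_below Z\<close>, of s] that by (auto simp: Z_def)
    ultimately have "g j (Inf Z) * g k 0 = g j 0 * g k (Inf Z)" for j
      by (rule ratio)
    then have "u (Inf Z) \<bullet> e j = 0" for j
      using T k u0 by (auto simp: Z_def g_def)
    with nonzero[of "Inf Z"] T show False
      by (auto simp: Z_def)
  qed
  have pos: "g k t / g k 0 > 0" if "t > 0" for t
  proof (rule ccontr)
    assume "\<not> g k t / g k 0 > 0"
    then have "\<exists>s\<ge>0. s \<le> t \<and> g k s / g k 0 = 0"
      using that nz[of 0]
      by (intro IVT2' continuous_intros continuous_on_subset[OF cg]) auto
    with nz show False by auto
  qed
  show ?thesis
  proof (rule that)
    show "g k t / g k 0 > 0" if "t > 0" for t
      using pos[OF that] .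
    show "u t \<bullet> e j = g k t / g k 0 * exp (- p j * t) * (u0 \<bullet> e j)" if "t > 0" for t j
    proof -
      have "g j t = g k t / g k 0 * (u0 \<bullet> e j)"
        using ratio[of t j] that nz nz[of 0] u0 by (simp add: field_simps g_def)
      moreover have "u t \<bullet> e j = exp (- p j * t) * g j t"
        by (simp add: g_def exp_minus)
      ultimately show ?thesis by simp
    qed
  qed
qed


section \<open>Projection to an eigenspace\<close>

lemma inner_sums:
  assumes "z \<in> H"
  shows "(\<lambda>j. (x \<bullet> e j) * (z \<bullet> e j)) sums (x \<bullet> z)"
proof -
  have "(\<lambda>j. (z \<bullet> e j) *\<^sub>R e j) sums z"
    using summable_sums[OF summable_orthonormal[OF summable_coeff[of z]]] expansion[OF assms]
    by simp
  from bounded_linear.sums[OF bounded_linear_inner_right this, of x]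
  show ?thesis by (simp add: mult.commute)
qed

lemma mem_eigenspace_iff:
  "v \<in> eigenspace H e p \<mu> \<longleftrightarrow> v \<in> H \<and> (\<forall>j. v \<bullet> e j \<noteq> 0 \<longrightarrow> p j = \<mu>)"
proof
  assume v: "v \<in> eigenspace H e p \<mu>"
  then have dom: "v \<in> spectral_dom H e p" and eq: "spectral_op e p v = \<mu> *\<^sub>R v"
    by (auto simp: eigenspace_def)
  have "p j = \<mu>" if "v \<bullet> e j \<noteq> 0" for j
    using coeff_spectral_op[OF dom, of j] that by (simp add: eq)
  with dom show "v \<in> H \<and> (\<forall>j. v \<bullet> e j \<noteq> 0 \<longrightarrow> p j = \<mu>)"
    by (auto simp: spectral_dom_def)
next
  assume v: "v \<in> H \<and> (\<forall>j. v \<bullet> e j \<noteq> 0 \<longrightarrow> p j = \<mu>)"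
  have eq: "p j * (v \<bullet> e j) = \<mu> * (v \<bullet> e j)" for j
    using v by auto
  have "(p j)\<^sup>2 * (v \<bullet> e j)\<^sup>2 = \<mu>\<^sup>2 * (v \<bullet> e j)\<^sup>2" for j
    using arg_cong[OF eq[of j], of "\<lambda>z. z\<^sup>2"] by (simp only: power_mult_distrib)
  then have "(\<lambda>j. (p j)\<^sup>2 * (v \<bullet> e j)\<^sup>2) = (\<lambda>j. \<mu>\<^sup>2 * (v \<bullet> e j)\<^sup>2)"
    by blast
  then have dom: "v \<in> spectral_dom H e p"
    using v by (simp only: spectral_dom_def mem_Collect_eq summable_mult summable_coeff)
  have "spectral_op e p v = (\<Sum>j. \<mu> *\<^sub>R ((v \<bullet> e j) *\<^sub>R e j))"
    by (simp add: spectral_op_def eq)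
  also have "\<dots> = \<mu> *\<^sub>R v"
    using v by (simp only: suminf_scaleR_right[symmetric] summable_orthonormal summable_coeff expansion)
  finally show "v \<in> eigenspace H e p \<mu>"
    using dom by (simp add: eigenspace_def)
qed

text \<open>
  The truncated expansion of \<open>v\<close> lies in the eigenspace, and the rest of \<open>v\<close> is supported on the
  indices at which all elements of the eigenspace have coefficient zero.
\<close>

lemma orth_proj_eigenspace:
  fixes p :: "nat \<Rightarrow> real" and \<mu> :: real
  assumes "v \<in> H"
  defines "w \<equiv> orth_proj (eigenspace H e p \<mu>) v"
  shows "w \<in> H" and "w \<bullet> e j = (if p j = \<mu> then v \<bullet> e j else 0)"
proof -
  define a where "a j = (if p j = \<mu> then v \<bullet> e j else 0)" for j
  define x where "x = (\<Sum>j. a j *\<^sub>R e j)"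
  let ?V = "eigenspace H e p \<mu>"
  have a: "summable (\<lambda>j. (a j)\<^sup>2)"
    by (rule summable_comparison_test'[OF summable_coeff[of v]]) (simp add: a_def)
  have xH: "x \<in> H" and xe: "x \<bullet> e j = a j" for j
    using a by (simp_all add: x_def suminf_orthonormal_in_H coeff_suminf_orthonormal)
  have xV: "x \<in> ?V"
    by (simp add: mem_eigenspace_iff xH xe a_def)
  have perp: "(v - x) \<bullet> z = 0" if "z \<in> ?V" for z
  proof -
    have "((v - x) \<bullet> e j) * (z \<bullet> e j) = 0" for j
      using that by (auto simp: mem_eigenspace_iff inner_diff_left xe a_def)
    moreover have "z \<in> H"
      using that by (simp add: mem_eigenspace_iff)
    ultimately have "(\<lambda>j. 0) sums ((v - x) \<bullet> z)"
      using inner_sums[of z "v - x"] by (simp only:)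
    then show ?thesis
      using sums_unique2 sums_zero by metis
  qed
  have "w = x"
    unfolding w_def orth_proj_def
  proof (rule the_equality)
    show "x \<in> ?V \<and> (\<forall>z\<in>?V. (v - x) \<bullet> z = 0)"
      using xV perp by blast
  next
    fix y
    assume y: "y \<in> ?V \<and> (\<forall>z\<in>?V. (v - y) \<bullet> z = 0)"
    then have "(y - x) \<bullet> z = 0" if "z \<in> ?V" for z
      using perp[OF that] that by (auto simp: inner_diff_left)
    then have "(y - x) \<bullet> y = 0" "(y - x) \<bullet> x = 0"
      using y xV by auto
    then have "(y - x) \<bullet> (y - x) = 0"
      by (simp add: inner_diff_right)
    then show "y = x" by simp
  qed
  then show "w \<in> H" "w \<bullet> e j = (if p j = \<mu> then v \<bullet> e j else 0)"
    by (simp_all add: xH xe a_def)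
qed

section \<open>Exponential decay\<close>

text \<open>
  The vector \<open>w\<close> is the part of the datum in the eigenspace of \<open>\<mu>\<close>, and all other active values are
  at least \<open>\<mu> + \<delta>\<close>. The weight \<open>q\<close> stands for a power of the operator and is controlled by its
  smoothing up to time \<open>\<tau>\<close>; the bound is stated for each coefficient relative to the one of the
  datum, so that summing over \<open>j\<close> costs nothing.
\<close>

lemma normalized_flow_decay:
  assumes flow: "normalized_flow H e p u0 u" and u0: "u0 \<in> unit_sphere H"
    and w: "w \<in> H" "w \<noteq> 0" "\<And>j. w \<bullet> e j = (if p j = \<mu> then u0 \<bullet> e j else 0)"
    and \<delta>: "\<delta> \<ge> 0" and gap: "\<And>j. u0 \<bullet> e j \<noteq> 0 \<Longrightarrow> p j = \<mu> \<or> \<mu> + \<delta> \<le> p j"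
    and \<tau>: "\<tau> > 0" and q: "\<And>j. 0 \<le> q j" "\<And>j. q j * exp (- p j * \<tau>) \<le> B"
  shows "\<exists>K>0. \<forall>t\<ge>\<tau>. \<forall>j.
    \<bar>q j * ((u t - w /\<^sub>R norm w) \<bullet> e j)\<bar> \<le> K * exp (- \<delta> * t) * \<bar>u0 \<bullet> e j\<bar>"
proof -
  define a where "a = norm w"
  define M where "M = B * exp (\<mu> * \<tau>)"
  have a: "a > 0" using w by (simp add: a_def)
  have "0 \<le> q 0 * exp (- p 0 * \<tau>)" using q(1) by simp
  also have "\<dots> \<le> B" by (rule q(2))
  finally have M: "0 \<le> M" by (simp add: M_def)
  obtain \<rho> where \<rho>: "\<And>t. t > 0 \<Longrightarrow> \<rho> t > 0"
    and coeff: "\<And>t j. t > 0 \<Longrightarrow> u t \<bullet> e j = \<rho> t * exp (- p j * t) * (u0 \<bullet> e j)"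
    using normalized_flow_coeff[OF flow] by blast
  have u0H: "u0 \<in> H" "norm u0 = 1"
    using u0 by (auto simp: unit_sphere_def)
  define K where "K = M / a ^ 3 + M * exp (\<delta> * \<tau>) / a + 1"
  have "K > 0" using M a by (auto simp: K_def intro: add_nonneg_pos)
  moreover have "\<bar>q j * ((u t - w /\<^sub>R norm w) \<bullet> e j)\<bar> \<le> K * exp (- \<delta> * t) * \<bar>u0 \<bullet> e j\<bar>"
    if t: "t \<ge> \<tau>" for t j
  proof -
    have t0: "t > 0" using t \<tau> by simp
    \<comment> \<open>By the normalization of \<open>u t\<close>, \<open>D\<close> is the norm of the datum damped by the factors \<open>x j\<close>.\<close>
    define D where "D = exp (\<mu> * t) / \<rho> t"
    define x where "x j = exp (- (p j - \<mu>) * t)" for j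
    define E where "E = exp (- \<delta> * t)"
    have D: "D > 0" using \<rho>[OF t0] by (simp add: D_def)
    have uD: "u t \<bullet> e j = x j * (u0 \<bullet> e j) / D" for j
      using \<rho>[OF t0] by (simp add: coeff[OF t0] D_def x_def exp_diff exp_minus field_simps exp_add)
    have uH: "u t \<in> H" "norm (u t) = 1"
      using flow t0 by (auto simp: normalized_flow_def unit_sphere_def)
    have E: "0 < E" "E \<le> 1"
      using \<delta> t0 by (auto simp: E_def)
    have xE: "x j \<le> E" if "u0 \<bullet> e j \<noteq> 0" "p j \<noteq> \<mu>" for j
    proof -
      have "\<delta> * t \<le> (p j - \<mu>) * t"
        using gap[OF that(1)] that(2) t0 by (intro mult_right_mono) auto
      then show ?thesis by (simp add: x_def E_def algebra_simps)
    qed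
    have "(\<lambda>j. (x j * (u0 \<bullet> e j))\<^sup>2) sums D\<^sup>2"
      using sums_mult[OF Parseval[OF uH(1)], of "D\<^sup>2"] D
      by (simp add: uD uH power_divide)
    then have S: "(\<lambda>j. (x j * (u0 \<bullet> e j))\<^sup>2 - (w \<bullet> e j)\<^sup>2) sums (D\<^sup>2 - a\<^sup>2)"
      unfolding a_def by (intro sums_diff Parseval w)
    have incr: "0 \<le> (x j * (u0 \<bullet> e j))\<^sup>2 - (w \<bullet> e j)\<^sup>2"
      "(x j * (u0 \<bullet> e j))\<^sup>2 - (w \<bullet> e j)\<^sup>2 \<le> E * (u0 \<bullet> e j)\<^sup>2" for j
    proof -
      have "(x j)\<^sup>2 * (u0 \<bullet> e j)\<^sup>2 \<le> E * (u0 \<bullet> e j)\<^sup>2" if "u0 \<bullet> e j \<noteq> 0" "p j \<noteq> \<mu>"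
      proof -
        have "0 \<le> x j" "x j \<le> 1"
          using order_trans[OF xE[OF that] E(2)] by (auto simp only: x_def exp_ge_zero)
        then have "(x j)\<^sup>2 \<le> E * 1"
          unfolding power2_eq_square using xE[OF that] E by (intro mult_mono) auto
        then show ?thesis by (intro mult_right_mono) auto
      qed
      then show "(x j * (u0 \<bullet> e j))\<^sup>2 - (w \<bullet> e j)\<^sup>2 \<le> E * (u0 \<bullet> e j)\<^sup>2"
        using E by (cases "u0 \<bullet> e j = 0") (auto simp: w(3) x_def power_mult_distrib)
    qed (auto simp: w(3) x_def)
    \<comment> \<open>The modes of \<open>\<mu>\<close> are undamped and cancel in \<open>D\<^sup>2 - a\<^sup>2\<close>; one factor \<open>E\<close> of the available \<open>E\<^sup>2\<close> suffices.\<close>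
    have "0 \<le> D\<^sup>2 - a\<^sup>2"
      by (rule sums_le[OF incr(1) sums_zero S])
    then have aD: "a \<le> D"
      using D by (intro power2_le_imp_le[of a D]) simp_all
    have "D\<^sup>2 - a\<^sup>2 \<le> E * (norm u0)\<^sup>2"
      by (rule sums_le[OF incr(2) S sums_mult[OF Parseval[OF u0H(1)]]])
    then have DE: "(D - a) * (D + a) \<le> E"
      by (simp add: u0H power2_eq_square algebra_simps)
    have inv: "1 / a - 1 / D \<le> E / a ^ 3"
    proof -
      have "(D - a) * a \<le> (D - a) * (D + a)"
        using aD D by (intro mult_left_mono) auto
      then have *: "(D - a) * a \<le> E" using DE by simp
      have "1 / a - 1 / D = (D - a) / (a * D)"
        using a D by (simp add: field_simps)
      also have "\<dots> \<le> (D - a) / (a * a)"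
        using a aD by (intro divide_left_mono mult_left_mono mult_pos_pos) auto
      also have "\<dots> = (D - a) * a / a ^ 3"
        using a by (simp add: power3_eq_cube)
      also have "\<dots> \<le> E / a ^ 3"
        using * a by (intro divide_right_mono) auto
      finally show ?thesis .
    qed
    have invnn: "0 \<le> 1 / a - 1 / D"
      using aD a by (simp add: field_simps)
    \<comment> \<open>Splitting \<open>t = \<tau> + (t - \<tau>)\<close>: the first part pays for the weight, the second for the decay.\<close>
    have qM: "q j * x j \<le> M * exp (\<delta> * \<tau>) * E" if "\<mu> + \<delta> \<le> p j"
    proof -
      have "x j = exp (- p j * \<tau>) * exp (\<mu> * \<tau>) * exp (- (p j - \<mu>) * (t - \<tau>))"
        by (simp add: x_def algebra_simps flip: exp_add)
      moreover have "\<delta> * (t - \<tau>) \<le> (p j - \<mu>) * (t - \<tau>)"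
        using that t by (intro mult_right_mono) auto
      then have "exp (- (p j - \<mu>) * (t - \<tau>)) \<le> exp (\<delta> * \<tau>) * E"
        by (simp add: E_def algebra_simps flip: exp_add)
      ultimately have "q j * x j \<le> (q j * exp (- p j * \<tau>) * exp (\<mu> * \<tau>)) * (exp (\<delta> * \<tau>) * E)"
        using q(1)[of j] by (simp add: mult.assoc mult_left_mono)
      also have "\<dots> \<le> M * (exp (\<delta> * \<tau>) * E)"
        unfolding M_def using q(2)[of j] E by (intro mult_right_mono) auto
      finally show ?thesis by (simp add: mult.assoc)
    qed
    have "(u t - w /\<^sub>R norm w) \<bullet> e j = (x j / D - (if p j = \<mu> then 1 / a else 0)) * (u0 \<bullet> e j)"
      by (simp add: inner_diff_left uD w(3) a_def[symmetric] left_diff_distrib divide_inverse)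
    then have main: "\<bar>q j * ((u t - w /\<^sub>R norm w) \<bullet> e j)\<bar>
        = q j * \<bar>x j / D - (if p j = \<mu> then 1 / a else 0)\<bar> * \<bar>u0 \<bullet> e j\<bar>"
      using q(1)[of j] by (simp add: abs_mult)
    have "q j * \<bar>x j / D - (if p j = \<mu> then 1 / a else 0)\<bar> \<le> K * E" if nz: "u0 \<bullet> e j \<noteq> 0"
    proof (cases "p j = \<mu>")
      case True
      have "q j \<le> M"
        using q(2)[of j] True by (simp add: M_def exp_minus field_simps)
      then have "q j * (1 / a - 1 / D) \<le> M * (E / a ^ 3)"
        using inv invnn M by (intro mult_mono) auto
      also have "\<dots> \<le> K * E"
        using M a E by (simp add: K_def algebra_simps)
      finally show ?thesis
        using True invnn \<open>K > 0\<close> E by (simp add: x_def abs_if)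
    next
      case False
      then have "q j * x j / D \<le> M * exp (\<delta> * \<tau>) * E / a"
        using qM gap[OF nz] aD a D q(1)[of j] M E by (intro frac_le) (auto simp: x_def)
      also have "\<dots> \<le> K * E"
        using M a E by (simp add: K_def algebra_simps)
      finally show ?thesis
        using False D by (simp add: x_def)
    qed
    then show ?thesis
      unfolding main E_def[symmetric] by (cases "u0 \<bullet> e j = 0") (auto intro: mult_right_mono)
  qed
  ultimately show ?thesis by blast
qed

end

section \<open>Active values and the gap\<close>

text \<open>
  Only finitely many terms of a sequence tending to infinity are at most \<open>p j0\<close>. This makes the
  minima in the definitions of the smallest active value and of the gap attained.
\<close>

lemma filterlim_at_top_attains_min:
  fixes p :: "nat \<Rightarrow> real"
  assumes "filterlim p at_top sequentially" "j0 \<in> S"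
  shows "\<exists>k\<in>S. \<forall>j\<in>S. p k \<le> p j"
proof -
  obtain N where N: "\<And>n. n \<ge> N \<Longrightarrow> p j0 \<le> p n"
    using assms(1) by (auto simp: filterlim_at_top eventually_sequentially)
  define k where "k = arg_min_on p (S \<inter> {..N + j0})"
  have ne: "finite (S \<inter> {..N + j0})" "S \<inter> {..N + j0} \<noteq> {}"
    using assms(2) by auto
  have k: "k \<in> S" "\<And>j. j \<in> S \<Longrightarrow> j \<le> N + j0 \<Longrightarrow> p k \<le> p j"
    using arg_min_if_finite[OF ne, of p] unfolding k_def by (auto simp: not_less)
  have "p k \<le> p j" if "j \<in> S" for j
  proof (cases "j \<le> N + j0")
    case False
    then show ?thesis using k(2)[of j0] N[of j] assms(2) by simp
  qed (use k that in auto)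
  with k(1) show ?thesis by blast
qed

lemma active_min_attained:
  assumes "filterlim p at_top sequentially" "u0 \<bullet> e j0 \<noteq> 0"
  shows "\<exists>k. u0 \<bullet> e k \<noteq> 0 \<and> p k = active_min e p u0"
    and "u0 \<bullet> e j \<noteq> 0 \<Longrightarrow> active_min e p u0 \<le> p j"
proof -
  have "\<exists>k\<in>{j. u0 \<bullet> e j \<noteq> 0}. \<forall>j\<in>{j. u0 \<bullet> e j \<noteq> 0}. p k \<le> p j"
    using assms by (intro filterlim_at_top_attains_min) auto
  then obtain k where k: "u0 \<bullet> e k \<noteq> 0" "\<And>j. u0 \<bullet> e j \<noteq> 0 \<Longrightarrow> p k \<le> p j"
    by blast
  have eq: "active_min e p u0 = p k"
    unfolding active_min_def active_spectrum_def using k by (intro Least_equality) auto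
  show "\<exists>k. u0 \<bullet> e k \<noteq> 0 \<and> p k = active_min e p u0"
    using eq k(1) by metis
  show "u0 \<bullet> e j \<noteq> 0 \<Longrightarrow> active_min e p u0 \<le> p j"
    unfolding eq by (rule k(2))
qed

lemma active_gap_attained:
  assumes "filterlim p at_top sequentially"
    and "active_spectrum e p u0 - {active_min e p u0} \<noteq> {}"
  shows "active_gap e p u0 > 0"
    and "u0 \<bullet> e j \<noteq> 0 \<Longrightarrow> p j = active_min e p u0 \<or> active_min e p u0 + active_gap e p u0 \<le> p j"
proof -
  define S where "S = {j. u0 \<bullet> e j \<noteq> 0 \<and> active_min e p u0 < p j}"
  obtain j0 where j0: "u0 \<bullet> e j0 \<noteq> 0" "p j0 \<noteq> active_min e p u0"
    using assms(2) by (auto simp: active_spectrum_def)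
  have min: "active_min e p u0 \<le> p j" if "u0 \<bullet> e j \<noteq> 0" for j
    using assms(1) j0(1) that by (rule active_min_attained(2))
  have "j0 \<in> S"
    using j0 min[OF j0(1)] by (simp add: S_def)
  with assms(1) have "\<exists>k\<in>S. \<forall>j\<in>S. p k \<le> p j"
    by (rule filterlim_at_top_attains_min)
  then obtain k where k: "k \<in> S" "\<And>j. j \<in> S \<Longrightarrow> p k \<le> p j"
    by blast
  have eq: "active_gap e p u0 = p k - active_min e p u0"
    unfolding active_gap_def active_spectrum_def
    using k by (intro Least_equality) (auto simp: S_def)
  show "active_gap e p u0 > 0"
    using k(1) by (simp add: eq S_def)
  show "p j = active_min e p u0 \<or> active_min e p u0 + active_gap e p u0 \<le> p j"
    if "u0 \<bullet> e j \<noteq> 0"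
    using k(2)[of j] min[OF that] that by (cases "j \<in> S") (auto simp: eq S_def)
qed

section \<open>Convergence of the flow\<close>

lemma filterlim_poly_at_top:
  fixes P :: "real poly"
  assumes "degree P \<ge> 1" "lead_coeff P > 0"
  shows "filterlim (poly P) at_top at_top"
proof (rule filterlim_at_infinity_imp_filterlim_at_top)
  show "filterlim (poly P) at_infinity at_top"
    using filterlim_poly_at_infinity[of P] assms(1) at_top_le_at_infinity
    by (auto intro: filterlim_mono)
  obtain n where "\<And>x. x \<ge> n \<Longrightarrow> poly P x \<ge> lead_coeff P"
    using poly_pinfty_gt_lc[OF assms(2)] by blast
  then show "eventually (\<lambda>x. poly P x > 0) at_top"
    using assms(2) unfolding eventually_at_top_linorder by (meson less_le_trans)
qed

text \<open>
  The smoothing estimate: at a positive time the exponential dominates every power of the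
  eigenvalues, so the sequence even tends to \<open>0\<close>.
\<close>

lemma powr_exp_bounded:
  fixes p :: "nat \<Rightarrow> real"
  assumes "filterlim p at_top sequentially" "t > 0"
  obtains B where "\<And>j. (p j + \<kappa>) powr \<theta> * exp (- p j * t) \<le> B"
proof -
  have "((\<lambda>x::real. (x + \<kappa>) powr \<theta> * exp (- x * t)) \<longlongrightarrow> 0) at_top"
    using assms(2) by real_asymp
  from filterlim_compose[OF this assms(1)]
  have "Bseq (\<lambda>j. (p j + \<kappa>) powr \<theta> * exp (- p j * t))"
    by (intro convergent_imp_Bseq convergentI)
  then obtain B where "\<And>j. norm ((p j + \<kappa>) powr \<theta> * exp (- p j * t)) \<le> B"
    by (auto simp: Bseq_def)
  with that show ?thesis by force
qed

theorem corollary3p12: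
  fixes \<Omega> :: "(real ^ 'n::finite) set"
    and lam :: "nat \<Rightarrow> real" and e :: "nat \<Rightarrow> (real ^ 'n) l2"
    and P :: "real poly" and \<kappa> \<theta> \<tau> :: real
    and u0 :: "(real ^ 'n) l2" and u :: "real \<Rightarrow> (real ^ 'n) l2"
  defines "H \<equiv> L2_on \<Omega>"
    and "p \<equiv> poly_spec P lam"
    and "q\<theta> \<equiv> power_spec P \<kappa> lam \<theta>"
    and "u_inf \<equiv> flow_limit (L2_on \<Omega>) e (poly_spec P lam) u0"
  assumes domain: "bounded_smooth_domain \<Omega>"
    and eigenbasis: "dirichlet_eigenbasis \<Omega> lam e"
    and degree: "degree P \<ge> 1" and leading: "lead_coeff P > 0"
    and kappa: "\<kappa> > max 0 (1 - min_poly_from P (lam 0))"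
    and u0: "u0 \<in> unit_sphere H"
    and theta: "\<theta> \<ge> 0" and tau: "\<tau> > 0"
    and flow: "normalized_flow H e p u0 u"
  shows "(\<forall>t>0. u t \<in> spectral_dom H e q\<theta>) \<and>
    u_inf \<in> spectral_dom H e q\<theta> \<and>
    ((\<lambda>t. norm (spectral_op e q\<theta> (u t - u_inf))) \<longlongrightarrow> 0) at_top \<and>
    (active_spectrum e p u0 - {active_min e p u0} \<noteq> {} \<longrightarrow>
      (\<exists>C>0. \<forall>t\<ge>\<tau>. norm (spectral_op e q\<theta> (u t - u_inf)) \<le> C * exp (- active_gap e p u0 * t)))"
proof -
  have ortho: "orthonormal_basis H e" and lam: "filterlim lam at_top sequentially"
    using eigenbasis by (auto simp: dirichlet_eigenbasis_def H_def orthonormal_basis_def)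
  interpret orthonormal_basis H e by (rule ortho)
  have p: "filterlim p at_top sequentially"
    unfolding p_def poly_spec_def
    by (rule filterlim_compose[OF filterlim_poly_at_top[OF degree leading] lam])
  define \<mu> where "\<mu> = active_min e p u0"
  define w where "w = orth_proj (eigenspace H e p \<mu>) u0"
  have u0H: "u0 \<in> H" "norm u0 = 1"
    using u0 by (auto simp: unit_sphere_def)
  then obtain j0 where "u0 \<bullet> e j0 \<noteq> 0"
    using unit_vector_nonzero_coeff[of u0] by auto
  then obtain k where k: "u0 \<bullet> e k \<noteq> 0" "p k = \<mu>"
    using active_min_attained(1)[OF p] unfolding \<mu>_def by blast
  have w: "w \<in> H" "w \<bullet> e j = (if p j = \<mu> then u0 \<bullet> e j else 0)" for j
    unfolding w_def using u0H(1) by (rule orth_proj_eigenspace)+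
  have w0: "w \<noteq> 0"
    using w(2)[of k] k by auto
  have u_inf: "u_inf = w /\<^sub>R norm w"
    by (simp add: u_inf_def flow_limit_def w_def \<mu>_def H_def p_def Let_def)
  have q: "q\<theta> j = (p j + \<kappa>) powr \<theta>" for j
    by (simp add: q\<theta>_def power_spec_def p_def poly_spec_def)

  have dom_u: "u t \<in> spectral_dom H e q\<theta>" if t: "t > 0" for t
  proof -
    obtain \<rho> where \<rho>: "\<rho> t > 0" "\<And>j. u t \<bullet> e j = \<rho> t * exp (- p j * t) * (u0 \<bullet> e j)"
      using normalized_flow_coeff[OF flow] t by metis
    obtain B where B: "\<And>j. (p j + \<kappa>) powr \<theta> * exp (- p j * t) \<le> B"
      using powr_exp_bounded[OF p t] by blast
    have "\<bar>q\<theta> j * (u t \<bullet> e j)\<bar> \<le> (\<rho> t * B) * \<bar>u0 \<bullet> e j\<bar>" for j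
    proof -
      have "\<bar>q\<theta> j * (u t \<bullet> e j)\<bar> = \<rho> t * ((p j + \<kappa>) powr \<theta> * exp (- p j * t)) * \<bar>u0 \<bullet> e j\<bar>"
        using \<rho>(1) by (simp add: q \<rho>(2) abs_mult)
      also have "\<dots> \<le> (\<rho> t * B) * \<bar>u0 \<bullet> e j\<bar>"
        using \<rho>(1) B[of j] by (intro mult_right_mono mult_left_mono) auto
      finally show ?thesis .
    qed
    moreover have "0 \<le> B"
      using B[of 0] by (rule order_trans[rotated]) simp
    moreover have "u t \<in> H"
      using flow t by (auto simp: normalized_flow_def unit_sphere_def)
    ultimately show ?thesis
      using spectral_op_dominated(1)[of u0 "\<rho> t * B" q\<theta> "u t"] u0H(1) \<rho>(1)
      by (simp add: spectral_dom_def)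
  qed

  have u_infH: "u_inf \<in> H"
    unfolding u_inf by (rule scaleR_in_H[OF w(1)])
  \<comment> \<open>On an eigenvector the weight is the constant \<open>(\<mu> + \<kappa>)\<^sup>\<theta>\<close>, so \<open>u_inf\<close> dominates itself.\<close>
  have "\<bar>q\<theta> j * (u_inf \<bullet> e j)\<bar> \<le> (\<mu> + \<kappa>) powr \<theta> * \<bar>u_inf \<bullet> e j\<bar>" for j
    by (simp add: u_inf w(2) q abs_mult)
  then have dom_inf: "u_inf \<in> spectral_dom H e q\<theta>"
    using spectral_op_dominated(1)[OF u_infH, of "(\<mu> + \<kappa>) powr \<theta>" q\<theta> u_inf] u_infH
    by (simp add: spectral_dom_def)

  have decay: "\<exists>K>0. \<forall>t\<ge>\<tau>. norm (spectral_op e q\<theta> (u t - u_inf)) \<le> K * exp (- \<delta> * t)"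
    if \<delta>: "\<delta> \<ge> 0" and gap: "\<And>j. u0 \<bullet> e j \<noteq> 0 \<Longrightarrow> p j = \<mu> \<or> \<mu> + \<delta> \<le> p j" for \<delta>
  proof -
    obtain B where B: "\<And>j. (p j + \<kappa>) powr \<theta> * exp (- p j * \<tau>) \<le> B"
      using powr_exp_bounded[OF p tau] by blast
    obtain K where K: "K > 0" "\<And>t j. t \<ge> \<tau> \<Longrightarrow>
        \<bar>q\<theta> j * ((u t - u_inf) \<bullet> e j)\<bar> \<le> (K * exp (- \<delta> * t)) * \<bar>u0 \<bullet> e j\<bar>"
      using normalized_flow_decay[OF flow u0 w(1) w0 w(2) \<delta> gap tau, of q\<theta> B] B
      unfolding u_inf q by auto
    have "norm (spectral_op e q\<theta> (u t - u_inf)) \<le> K * exp (- \<delta> * t)" if "t \<ge> \<tau>" for t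
      using spectral_op_dominated(2)[OF u0H(1) _ K(2)[OF that]] K(1) u0H(2) by simp
    with K(1) show ?thesis by blast
  qed

  \<comment> \<open>Without a second active value every \<open>\<delta>\<close> satisfies the gap condition; \<open>1\<close> is one choice.\<close>
  define \<delta> where "\<delta> = (if active_spectrum e p u0 - {\<mu>} \<noteq> {} then active_gap e p u0 else 1)"
  have \<delta>: "\<delta> > 0" "\<And>j. u0 \<bullet> e j \<noteq> 0 \<Longrightarrow> p j = \<mu> \<or> \<mu> + \<delta> \<le> p j"
    using active_gap_attained[OF p, of e u0]
    by (auto simp: \<delta>_def \<mu>_def active_spectrum_def)
  obtain K where K: "K > 0"
    "\<And>t. t \<ge> \<tau> \<Longrightarrow> norm (spectral_op e q\<theta> (u t - u_inf)) \<le> K * exp (- \<delta> * t)"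
    using decay[OF less_imp_le[OF \<delta>(1)] \<delta>(2)] by blast
  have "((\<lambda>t. K * exp (- \<delta> * t)) \<longlongrightarrow> 0) at_top"
    using \<delta>(1) by real_asymp
  then have "((\<lambda>t. norm (spectral_op e q\<theta> (u t - u_inf))) \<longlongrightarrow> 0) at_top"
    by (rule Lim_null_comparison[rotated]) (use K(2) in \<open>auto intro: eventually_at_top_linorderI\<close>)
  moreover have "\<exists>C>0. \<forall>t\<ge>\<tau>. norm (spectral_op e q\<theta> (u t - u_inf)) \<le> C * exp (- active_gap e p u0 * t)"
    if "active_spectrum e p u0 - {active_min e p u0} \<noteq> {}"
    using K that by (auto simp: \<delta>_def \<mu>_def)
  ultimately show ?thesis
    using dom_u dom_inf by blast
qed

end
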